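(* Let $K$ be a field and let $q\in K$ be such that $q\neq0$ and $\{n\}_q\neq0$ for every non-zero $n\in\mathbb{Z}$. Let $0\neq P\in H_K(q)$ have order $m$, and let $\ker P$ be its kernel when acting on $\mathcal{L}$. Then $$d_{\max}-d_{\min}\leq\dim\ker P\leq d_{\max}-d_{\min}+\min(N_{\max},N_{\min})\leq d_{\max}-d_{\min}+m.$$
   Context: For $n\in\mathbb{Z}$ the $q$-integer is $\{n\}_q=\frac{q^n-1}{q-1}$ if $q\neq1$ and $\{n\}_q=n$ (in $K$) if $q=1$. $H_K(q)$ is the unital associative $K$-algebra generated by $A,B$ subject to $AB-qBA=I$. Let $\mathcal{L}$ be the $K$-vector space of all formal two-sided Laurent series $\sum_{n=-\infty}^{\infty}a_nt^n$, $a_n\in K$ (all functions $\mathbb{Z}\to K$), with endomorphisms $$M\Big(\sum_n a_nt^n\Big)=\sum_n a_nt^{n+1},\qquad D_q\Big(\sum_n a_nt^n\Big)=\sum_n a_n\{n\}_qt^{n-1}.$$ Sending $A\mapsto D_q$, $B\mapsto M$ makes $\mathcal{L}$ a faithful $H_K(q)$-module, and $H_K(q)$ is identified with its image in $\operatorname{End}_K(\mathcal{L})$. Every non-zero $P\in H_K(q)$ can be written uniquely as $P=\sum_{j=0}^m p_j(M)D_q^j$ with $m\ge0$, $p_j\in K[X]$, $p_m\neq0$; $m$ is the order of $P$. Write $p_j(X)=\sum_ip_{j,i}X^i$ and, for $d,k\in\mathbb{Z}$, put $$\beta_d(k)=\sum_{i-j=d}p_{j,i}\{k\}_q\{k-1\}_q\cdots\{k-j+1\}_q,$$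 where the product of $q$-integers is $1$ if $j=0$; thus $Pt^k=\sum_d\beta_d(k)t^{d+k}$. View $\beta_d$ as a function $\mathbb{Z}\to K$. Put $d_{\max}=\max\{d:\beta_d\neq0\}$, $d_{\min}=\min\{d:\beta_d\neq0\}$, $N_{\max}=\#\{l\in\mathbb{Z}:\beta_{d_{\max}}(l)=0\}$, $N_{\min}=\#\{l\in\mathbb{Z}:\beta_{d_{\min}}(l)=0\}$ (these numbers are finite). *)

theory Defs
  imports Complex_Main "HOL-Library.Function_Algebras" "HOL-Computational_Algebra.Polynomial"
begin

text \<open>
  The zero, sums and differences of Laurent series and of operators are the pointwise ones of
  \<^theory>\<open>HOL-Library.Function_Algebras\<close>. The product of operators is composition,
  written with \<open>\<circ>\<close> and \<open>^^\<close> (the type class product on functions is pointwise and is not used).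
\<close>

definition q_int :: "'a::field \<Rightarrow> int \<Rightarrow> 'a" where
  "q_int q n = (if q = 1 then of_int n else (q powi n - 1) / (q - 1))"

type_synonym 'a laurent = "int \<Rightarrow> 'a"

type_synonym 'a laurent_op = "'a laurent \<Rightarrow> 'a laurent"

definition laurent_scale :: "'a::field \<Rightarrow> 'a laurent \<Rightarrow> 'a laurent" where
  "laurent_scale c f = (\<lambda>n. c * f n)"

global_interpretation laurent: vector_space laurent_scale
  defines laurent_dim = laurent.dim
    and laurent_span = laurent.span
  by unfold_locales (auto simp: laurent_scale_def algebra_simps)

definition laurent_finite_dim :: "'a::field laurent set \<Rightarrow> bool" where
  "laurent_finite_dim V \<longleftrightarrow> (\<exists>B. finite B \<and> laurent_span B = V)"

definition op_scale :: "'a::field \<Rightarrow> 'a laurent_op \<Rightarrow> 'a laurent_op" where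
  "op_scale c P = (\<lambda>f. laurent_scale c (P f))"

definition shift_op :: "'a::field laurent_op" where
  "shift_op f = (\<lambda>n. f (n - 1))"

definition q_deriv :: "'a::field \<Rightarrow> 'a laurent_op" where
  "q_deriv q f = (\<lambda>n. q_int q (n + 1) * f (n + 1))"

text \<open>
  The algebra $H_K(q)$, identified with its image in the endomorphism algebra of the space of
  Laurent series, that is, the unital subalgebra generated by $D_q$ (the image of $A$) and
  $M$ (the image of $B$).
\<close>

inductive_set q_heisenberg :: "'a::field \<Rightarrow> 'a laurent_op set" for q :: 'a where
  id: "id \<in> q_heisenberg q"
| deriv: "q_deriv q \<in> q_heisenberg q"
| shift: "shift_op \<in> q_heisenberg q"
| scale: "P \<in> q_heisenberg q \<Longrightarrow> op_scale c P \<in> q_heisenberg q"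
| add: "P \<in> q_heisenberg q \<Longrightarrow> Q \<in> q_heisenberg q \<Longrightarrow> P + Q \<in> q_heisenberg q"
| comp: "P \<in> q_heisenberg q \<Longrightarrow> Q \<in> q_heisenberg q \<Longrightarrow> P \<circ> Q \<in> q_heisenberg q"

lemma q_int_Suc: "q \<noteq> 0 \<Longrightarrow> q_int q (n + 1) = q * q_int q n + 1"
  by (auto simp: q_int_def power_int_add divide_simps) (auto simp: algebra_simps)

lemma q_heisenberg_relation:
  assumes "q \<noteq> 0"
  shows "(q_deriv q \<circ> shift_op) - op_scale q (shift_op \<circ> q_deriv q) = id"
proof (intro ext)
  fix f :: "'a laurent" and n :: int
  have "((q_deriv q \<circ> shift_op) - op_scale q (shift_op \<circ> q_deriv q)) f n
      = q_int q (n + 1) * f n - q * (q_int q n * f n)"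
    by (simp add: q_deriv_def shift_op_def op_scale_def laurent_scale_def)
  then show "((q_deriv q \<circ> shift_op) - op_scale q (shift_op \<circ> q_deriv q)) f n = id f n"
    by (simp only: q_int_Suc[OF assms]) (simp add: algebra_simps)
qed

definition poly_shift :: "'a::field poly \<Rightarrow> 'a laurent_op" where
  "poly_shift p = (\<Sum>i\<le>degree p. op_scale (coeff p i) (shift_op ^^ i))"

text \<open>
  A family $p_0, \dots, p_m$ in $K[X]$ with $p_m \neq 0$ is a non-zero polynomial of degree $m$
  with coefficients in $K[X]$. The outer variable stands for $D_q$, the inner one for $M$.
\<close>

definition op_of_poly :: "'a::field \<Rightarrow> 'a poly poly \<Rightarrow> 'a laurent_op" where
  "op_of_poly q p = (\<Sum>j\<le>degree p. poly_shift (coeff p j) \<circ> (q_deriv q ^^ j))"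

text \<open>
  If $q \<noteq> 0$ and the $q$-integers $\{n\}_q$, $n \<noteq> 0$, do not vanish, then every element
  of \<open>q_heisenberg q\<close> has exactly one normal form.
\<close>

definition normal_form :: "'a::field \<Rightarrow> 'a laurent_op \<Rightarrow> 'a poly poly" where
  "normal_form q P = (THE p. P = op_of_poly q p)"

definition op_order :: "'a::field \<Rightarrow> 'a laurent_op \<Rightarrow> nat" where
  "op_order q P = degree (normal_form q P)"

definition q_falling :: "'a::field \<Rightarrow> int \<Rightarrow> nat \<Rightarrow> 'a" where
  "q_falling q k j = (\<Prod>i<j. q_int q (k - int i))"

text \<open>In \<open>beta\<close>, the sum over $i - j = d$ is taken over $j$, with $i = j + d \ge 0$.\<close>

definition beta_poly :: "'a::field \<Rightarrow> 'a poly poly \<Rightarrow> int \<Rightarrow> int \<Rightarrow> 'a" where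
  "beta_poly q p d k =
     (\<Sum>j \<in> {j. j \<le> degree p \<and> 0 \<le> int j + d}.
        coeff (coeff p j) (nat (int j + d)) * q_falling q k j)"

definition beta :: "'a::field \<Rightarrow> 'a laurent_op \<Rightarrow> int \<Rightarrow> int \<Rightarrow> 'a" where
  "beta q P = beta_poly q (normal_form q P)"

text \<open>
  Under the same assumption on $q$ and for a non-zero element of \<open>q_heisenberg q\<close>, the arguments
  of \<open>Max\<close>, \<open>Min\<close> and \<open>card\<close> below are finite and those of \<open>Max\<close> and \<open>Min\<close> non-empty.
\<close>

definition d_max :: "'a::field \<Rightarrow> 'a laurent_op \<Rightarrow> int" where
  "d_max q P = Max {d. beta q P d \<noteq> 0}"

definition d_min :: "'a::field \<Rightarrow> 'a laurent_op \<Rightarrow> int" where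
  "d_min q P = Min {d. beta q P d \<noteq> 0}"

definition N_max :: "'a::field \<Rightarrow> 'a laurent_op \<Rightarrow> nat" where
  "N_max q P = card {l. beta q P (d_max q P) l = 0}"

definition N_min :: "'a::field \<Rightarrow> 'a laurent_op \<Rightarrow> nat" where
  "N_min q P = card {l. beta q P (d_min q P) l = 0}"

definition op_kernel :: "'a::field laurent_op \<Rightarrow> 'a laurent set" where
  "op_kernel P = {f. P f = 0}"

end

theory Submission
  imports Defs
begin

text \<open>
  The coefficient of \<open>t ^ n\<close> in \<open>P f\<close> is the sum of \<open>\<beta>\<^sub>d (n - d) * f (n - d)\<close> over \<open>d\<close>, so the kernel of
  \<open>P\<close> is the solution space of a two-sided linear recurrence of order \<open>r = d\<^sub>m\<^sub>a\<^sub>x - d\<^sub>m\<^sub>i\<^sub>n\<close> whose extreme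
  coefficients \<open>\<beta>\<close> have finitely many zeros. Upper bounds: a solution is determined by \<open>r\<close> consecutive
  values to one side of all these zeros together with the values that the recurrence leaves free when
  it is run towards the other side, one for each zero of the relevant extreme coefficient.
  Lower bound: sequences satisfying the recurrence outside a window of length \<open>w\<close> containing the zeros
  have \<open>w + r\<close> free parameters, and the window imposes \<open>w\<close> further equations.
\<close>

subsection \<open>Subspaces of finite codimension\<close>

context vector_space
begin

text \<open>One linear equation costs at most one generator: a vector of \<open>V\<close> on which
  \<phi> is non-zero spans a complement of the kernel. If there is none, the kernel is all of
  \<open>V\<close> and \<open>0\<close> can be adjoined.\<close>

lemma span_insert_kernel:
  fixes \<phi> :: "'b \<Rightarrow> 'a"
  assumes V: "subspace V"
    and add: "\<And>x y. \<phi> (x + y) = \<phi> x + \<phi> y"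
    and scale: "\<And>c x. \<phi> (c *s x) = c * \<phi> x"
    and B: "span B = {x \<in> V. \<phi> x = 0}"
  shows "\<exists>b. span (insert b B) = V"
proof (cases "\<exists>b\<in>V. \<phi> b \<noteq> 0")
  case True
  then obtain b where b: "b \<in> V" "\<phi> b \<noteq> 0" by auto
  have "B \<subseteq> V" using B span_superset[of B] by auto
  then have "span (insert b B) \<subseteq> V" using b V by (intro span_minimal) auto
  moreover have "x \<in> span (insert b B)" if x: "x \<in> V" for x
  proof -
    define c where "c = \<phi> x / \<phi> b"
    have "x - c *s b = x + (- c) *s b" by simp
    then have "\<phi> (x - c *s b) = \<phi> x + (- c) * \<phi> b" by (simp only: add scale)
    then have "\<phi> (x - c *s b) = 0" using b by (simp add: c_def)
    moreover have "x - c *s b \<in> V" using V x b by (intro subspace_diff subspace_scale)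
    ultimately have "x - c *s b \<in> span B" using B by auto
    then show ?thesis by (auto simp: span_insert)
  qed
  ultimately show ?thesis by blast
next
  case False
  then have "{x \<in> V. \<phi> x = 0} = V" by auto
  moreover have "0 \<in> span B" by (rule span_zero)
  ultimately have "span (insert 0 B) = V" using B by (simp add: span_insert_0)
  then show ?thesis by blast
qed

text \<open>The equations are imposed one at a time, each costing at most one generator. Spanning
  sets replace \<open>dim\<close>, whose value is 0 on infinite-dimensional spaces, so that finite
  dimension is obtained along with the bound.\<close>

lemma span_finite_codim:
  fixes \<phi> :: "'k \<Rightarrow> 'b \<Rightarrow> 'a"
  assumes "finite K" "subspace V"
    and add: "\<And>k x y. \<phi> k (x + y) = \<phi> k x + \<phi> k y"
    and scale: "\<And>k c x. \<phi> k (c *s x) = c * \<phi> k x"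
    and "finite B" "span B = {x \<in> V. \<forall>k\<in>K. \<phi> k x = 0}"
  shows "\<exists>C. finite C \<and> span C = V \<and> card C \<le> card B + card K"
  using assms(1,2,6)
proof (induction K arbitrary: V rule: finite_induct)
  case empty
  then show ?case using \<open>finite B\<close> by auto
next
  case (insert k K)
  let ?W = "{x \<in> V. \<phi> k x = 0}"
  have 0: "\<phi> k 0 = 0" using scale[of k 0 0] by simp
  have W: "subspace ?W"
    using insert.prems(1) by (auto simp: subspace_def add scale 0)
  have "span B = {x \<in> ?W. \<forall>k\<in>K. \<phi> k x = 0}"
    using insert.prems(2) by auto
  from insert.IH[OF W this] obtain C
    where C: "finite C" "span C = ?W" "card C \<le> card B + card K" by auto
  obtain b where b: "span (insert b C) = V"
    using span_insert_kernel[of V "\<phi> k", OF insert.prems(1) add scale C(2)] by auto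
  have "card (insert b C) \<le> card B + card (insert k K)"
    using C insert.hyps card_insert_le_m1[of "Suc (card C)" C b] by (simp add: card_insert_if)
  then show ?case using b C(1) by (intro exI[of _ "insert b C"]) auto
qed

text \<open>The case of a zero solution space. It yields the upper bounds, with evaluations at
  finitely many positions as functionals.\<close>

lemma dim_le_of_separating:
  fixes \<phi> :: "'k \<Rightarrow> 'b \<Rightarrow> 'a"
  assumes "finite K" "subspace V"
    and add: "\<And>k x y. \<phi> k (x + y) = \<phi> k x + \<phi> k y"
    and scale: "\<And>k c x. \<phi> k (c *s x) = c * \<phi> k x"
    and sep: "\<And>x. x \<in> V \<Longrightarrow> \<forall>k\<in>K. \<phi> k x = 0 \<Longrightarrow> x = 0"
  shows "(\<exists>C. finite C \<and> span C = V) \<and> dim V \<le> card K"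
proof -
  have 0: "\<phi> k 0 = 0" for k using scale[of k 0 0] by simp
  have "span {} = {x \<in> V. \<forall>k\<in>K. \<phi> k x = 0}"
    using sep 0 assms(2) by (auto simp: subspace_0)
  from span_finite_codim[of K V \<phi> "{}", OF assms(1,2) add scale finite.emptyI this]
  obtain C where "finite C" "span C = V" "card C \<le> card K" by auto
  then show ?thesis using dim_le_card[of V C] by auto
qed

text \<open>A basis of \<open>W\<close> extends to a spanning set of \<open>V\<close> by at most
  \<open>card K\<close> vectors, and no independent set in \<open>V\<close> is larger than that. It
  yields the lower bound.\<close>

lemma card_le_dim_plus_codim:
  fixes \<phi> :: "'k \<Rightarrow> 'b \<Rightarrow> 'a"
  assumes "finite K" "subspace V"
    and add: "\<And>k x y. \<phi> k (x + y) = \<phi> k x + \<phi> k y"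
    and scale: "\<And>k c x. \<phi> k (c *s x) = c * \<phi> k x"
    and W: "W = {x \<in> V. \<forall>k\<in>K. \<phi> k x = 0}"
    and fin: "\<exists>B. finite B \<and> span B = W"
    and S: "independent S" "S \<subseteq> V"
  shows "card S \<le> dim W + card K"
proof -
  obtain B where B: "B \<subseteq> W" "independent B" "W \<subseteq> span B" "card B = dim W"
    using basis_exists by blast
  have "finite B"
    using B fin independent_span_bound by metis
  have sW: "subspace W" using fin subspace_span by blast
  have "span B = W" using B sW by (simp add: span_subspace)
  from span_finite_codim[of K V \<phi> B, OF assms(1,2) add scale \<open>finite B\<close> this[unfolded W]]
  obtain C where "finite C" "span C = V" "card C \<le> card B + card K" by auto
  then show ?thesis using independent_span_bound[of C S] S B(4) by fastforce
qed

end

subsection \<open>Two-sided linear recurrences\<close>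

text \<open>Equation \<open>k\<close> reads the entries \<open>f k\<close> to
  \<open>f (k + r)\<close>. For the operator it will be the coefficient of t^(k + d_max), with
  \<beta> at d_max as \<open>a 0\<close> and, up to a translation, \<beta> at d_min as
  \<open>a r\<close>.\<close>

definition recurrence :: "(nat \<Rightarrow> int \<Rightarrow> 'a::field) \<Rightarrow> nat \<Rightarrow> int \<Rightarrow> 'a laurent \<Rightarrow> 'a" where
  "recurrence a r k f = (\<Sum>i\<le>r. a i k * f (k + int i))"

lemma recurrence_add: "recurrence a r k (f + g) = recurrence a r k f + recurrence a r k g"
  by (simp add: recurrence_def algebra_simps sum.distrib)

lemma recurrence_scale: "recurrence a r k (laurent_scale c f) = c * recurrence a r k f"
  by (simp add: recurrence_def laurent_scale_def sum_distrib_left algebra_simps)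

lemma recurrence_first:
  "recurrence a r k f = a 0 k * f k + (\<Sum>i\<in>{1..r}. a i k * f (k + int i))"
  by (simp add: recurrence_def atMost_atLeast0 sum.atLeast_Suc_atMost[of 0 r])

lemma recurrence_last:
  "recurrence a r k f = a r k * f (k + int r) + (\<Sum>i<r. a i k * f (k + int i))"
  by (cases r) (simp_all add: recurrence_def lessThan_Suc_atMost add.commute)

lemma subspace_recurrence:
  "laurent.subspace {f. \<forall>k\<in>K. recurrence a r k f = 0}"
  unfolding laurent.subspace_def
  by (auto simp: recurrence_add recurrence_scale) (simp add: recurrence_def)

text \<open>Equation \<open>k\<close> determines \<open>f (k + r)\<close> from the \<open>r\<close>
  entries before it unless \<open>a r k = 0\<close>. Those exceptional entries are free, hence
  assumed to vanish.\<close>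

lemma recurrence_extend_right:
  assumes f: "\<And>k. k \<ge> u \<Longrightarrow> recurrence a r k f = 0"
    and lead: "\<And>k. k \<ge> u \<Longrightarrow> a r k = 0 \<Longrightarrow> f (k + int r) = 0"
    and init: "\<And>i. u \<le> i \<Longrightarrow> i < u + int r \<Longrightarrow> f i = 0"
    and "n \<ge> u"
  shows "f n = 0"
  using \<open>n \<ge> u\<close>
proof (induction "nat (n - u)" arbitrary: n rule: less_induct)
  case less
  show ?case
  proof (cases "n < u + int r")
    case False
    define k where "k = n - int r"
    have k: "k \<ge> u" "n = k + int r" using False by (auto simp: k_def)
    have "(\<Sum>i<r. a i k * f (k + int i)) = 0"
      using k by (intro sum.neutral) (auto intro!: less.hyps)
    then have "a r k * f n = 0" using f[OF k(1)] k by (simp add: recurrence_last)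
    then show ?thesis using lead[OF k(1)] k by auto
  qed (use init less.prems in auto)
qed

text \<open>The mirror image: equation \<open>k\<close> determines \<open>f k\<close> from the
  \<open>r\<close> entries after it unless \<open>a 0 k = 0\<close>.\<close>

lemma recurrence_extend_left:
  assumes f: "\<And>k. k < v \<Longrightarrow> recurrence a r k f = 0"
    and lead: "\<And>k. k < v \<Longrightarrow> a 0 k = 0 \<Longrightarrow> f k = 0"
    and init: "\<And>i. v \<le> i \<Longrightarrow> i < v + int r \<Longrightarrow> f i = 0"
    and "n < v + int r"
  shows "f n = 0"
  using \<open>n < v + int r\<close>
proof (induction "nat (v + int r - n)" arbitrary: n rule: less_induct)
  case less
  show ?case
  proof (cases "n < v")
    case True
    have "(\<Sum>i\<in>{1..r}. a i n * f (n + int i)) = 0"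
      using True by (intro sum.neutral) (auto intro!: less.hyps)
    then have "a 0 n * f n = 0" using f[OF True] by (simp add: recurrence_first)
    then show ?thesis using lead[OF True] by auto
  qed (use init less.prems in auto)
qed

text \<open>Arbitrary values on the window extend outwards, because the equations
  \<open>k < u\<close> can be solved for \<open>f k\<close> and the equations
  \<open>k \<ge> v\<close> for \<open>f (k + r)\<close>. The \<open>v - u\<close> equations in
  between are not imposed.\<close>

lemma recurrence_solution_exists:
  assumes left: "\<And>k. k < u \<Longrightarrow> a 0 k \<noteq> 0" and right: "\<And>k. v \<le> k \<Longrightarrow> a r k \<noteq> 0"
    and "u \<le> v"
  shows "\<exists>f. (\<forall>n. u \<le> n \<and> n < v + int r \<longrightarrow> f n = g n)
    \<and> (\<forall>k. k < u \<or> v \<le> k \<longrightarrow> recurrence a r k f = 0)"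
proof -
  define F where "F f n = (if n < u then - (\<Sum>i\<in>{1..r}. a i n * f (n + int i)) / a 0 n
     else if v + int r \<le> n then - (\<Sum>i<r. a i (n - int r) * f (n - int r + int i)) / a r (n - int r)
     else g n)" for f n
  \<comment> \<open>A step to the left of \<open>u\<close> may read entries at or beyond
    \<open>u\<close>, where the measure changes its formula. Counting from \<open>v + r\<close>
    makes it decrease there too.\<close>
  define R where "R = measure (\<lambda>n. nat (if n < u then v + int r - n else n - u))"
  have "adm_wf R F"
    unfolding adm_wf_def
  proof (intro allI impI)
    fix f h :: "'a laurent" and n
    assume eq: "\<forall>m. (m, n) \<in> R \<longrightarrow> f m = h m"
    have "f (n + int i) = h (n + int i)" if "n < u" "i \<in> {1..r}" for i
      using that \<open>u \<le> v\<close> by (intro eq[rule_format]) (auto simp: R_def)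
    moreover have "f (n - int r + int i) = h (n - int r + int i)" if "v + int r \<le> n" "i < r" for i
      using that \<open>u \<le> v\<close> by (intro eq[rule_format]) (auto simp: R_def)
    ultimately show "F f n = F h n" by (simp add: F_def)
  qed
  moreover have "wf R" by (simp add: R_def)
  ultimately obtain f where f: "f = F f" using wfrec_fixpoint by blast
  have "f n = g n" if "u \<le> n" "n < v + int r" for n
    using that by (subst f) (simp add: F_def)
  moreover have "recurrence a r k f = 0" if "k < u" for k
  proof -
    have "f k = - (\<Sum>i\<in>{1..r}. a i k * f (k + int i)) / a 0 k"
      using that by (subst f) (simp add: F_def)
    then show ?thesis using left[OF that] by (simp add: recurrence_first)
  qed
  moreover have "recurrence a r k f = 0" if "v \<le> k" for k
  proof -
    have "f (k + int r) = - (\<Sum>i<r. a i k * f (k + int i)) / a r k"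
      using that \<open>u \<le> v\<close> by (subst f) (simp add: F_def)
    then show ?thesis using right[OF that] by (simp add: recurrence_last)
  qed
  ultimately show ?thesis by blast
qed

text \<open>Evaluating a vanishing combination at \<open>j\<close> isolates the coefficient of
  \<open>e j\<close>.\<close>

lemma independent_of_dual:
  fixes e :: "int \<Rightarrow> 'a::field laurent"
  assumes "finite I" and e: "\<And>i j. i \<in> I \<Longrightarrow> j \<in> I \<Longrightarrow> e i j = (if i = j then 1 else 0)"
  shows "laurent.independent (e ` I)" and "card (e ` I) = card I"
proof -
  have inj: "inj_on e I"
    by (rule inj_onI) (metis e zero_neq_one)
  then show "card (e ` I) = card I" by (rule card_image)
  show "laurent.independent (e ` I)"
  proof (rule laurent.independent_if_scalars_zero)
    fix c x
    assume sum: "(\<Sum>x\<in>e ` I. laurent_scale (c x) x) = 0" and "x \<in> e ` I"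
    then obtain j where j: "j \<in> I" "x = e j" by auto
    have ev: "(\<Sum>i\<in>A. laurent_scale (c (e i)) (e i)) j = (\<Sum>i\<in>A. c (e i) * e i j)" for A
      by (induction A rule: infinite_finite_induct) (auto simp: laurent_scale_def)
    have "0 = (\<Sum>i\<in>I. laurent_scale (c (e i)) (e i)) j"
      using sum by (simp add: sum.reindex[OF inj])
    also have "\<dots> = (\<Sum>i\<in>I. c (e i) * e i j)" by (rule ev)
    also have "\<dots> = (\<Sum>i\<in>I. if i = j then c (e i) else 0)"
      using j by (intro sum.cong) (auto simp: e)
    also have "\<dots> = c x" using assms(1) j by simp
    finally show "c x = 0" by simp
  qed (use assms in auto)
qed

lemma recurrence_kernel_dim:
  fixes a :: "nat \<Rightarrow> int \<Rightarrow> 'a::field"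
  assumes Z0: "finite {k. a 0 k = 0}" and Zr: "finite {k. a r k = 0}"
  defines "V \<equiv> {f. \<forall>k. recurrence a r k f = 0}"
  shows "laurent_finite_dim V" and "r \<le> laurent_dim V"
    and "laurent_dim V \<le> r + card {k. a 0 k = 0}"
    and "laurent_dim V \<le> r + card {k. a r k = 0}"
proof -
  \<comment> \<open>All zeros of \<open>a 0\<close> and \<open>a r\<close> lie in the half-open
    interval from \<open>u = - M\<close> to \<open>v = M + 1\<close>. The inserted 0 keeps
    \<open>Max\<close> defined and \<open>M\<close> non-negative.\<close>
  define M where "M = Max (insert 0 (abs ` ({k. a 0 k = 0} \<union> {k. a r k = 0})))"
  define u where "u = - M"
  define v where "v = M + 1"
  have M: "\<bar>k\<bar> \<le> M" if "a 0 k = 0 \<or> a r k = 0" for k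
    unfolding M_def using that Z0 Zr by (intro Max_ge) auto
  have "0 \<le> M" unfolding M_def using Z0 Zr by (intro Max_ge) auto
  then have "u \<le> v" by (simp add: u_def v_def)
  have outside: "a 0 k \<noteq> 0" "a r k \<noteq> 0" if "k < u \<or> v \<le> k" for k
    using that M[of k] by (auto simp: u_def v_def)
  have sV: "laurent.subspace V"
    using subspace_recurrence[of UNIV] by (simp add: V_def)

  \<comment> \<open>Start to the right of all zeros: everything further right is forced, and running
    left leaves one free entry \<open>f k\<close> for each zero \<open>k\<close> of
    \<open>a 0\<close>.\<close>
  have "(\<exists>C. finite C \<and> laurent_span C = V) \<and> laurent_dim V \<le> card ({v..<v + int r} \<union> {k. a 0 k = 0})"
  proof (rule laurent.dim_le_of_separating[where \<phi> = "\<lambda>k f. f k"])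
    fix f assume "f \<in> V" and z: "\<forall>k\<in>{v..<v + int r} \<union> {k. a 0 k = 0}. f k = 0"
    then have f: "recurrence a r k f = 0" for k by (simp add: V_def)
    have L: "f n = 0" if "n < v + int r" for n
      by (rule recurrence_extend_left[of v a r]) (use f z that in auto)
    have "f n = 0" if "v \<le> n" for n
      by (rule recurrence_extend_right[of v a r]) (use f outside L that in auto)
    moreover have "n < v + int r \<or> v \<le> n" for n by linarith
    ultimately show "f = 0" using L by fastforce
  qed (use Z0 sV in \<open>auto simp: laurent_scale_def\<close>)
  moreover have "card ({v..<v + int r} \<union> {k. a 0 k = 0}) \<le> r + card {k. a 0 k = 0}"
    using card_Un_le[of "{v..<v + int r}" "{k. a 0 k = 0}"] by simp
  ultimately show fd: "laurent_finite_dim V" and "laurent_dim V \<le> r + card {k. a 0 k = 0}"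
    by (auto simp: laurent_finite_dim_def)

  \<comment> \<open>Start at \<open>u\<close> and run right: a zero \<open>k\<close> of
    \<open>a r\<close> frees the entry at \<open>k + r\<close>, hence the translation.\<close>
  let ?Z = "(\<lambda>k. k + int r) ` {k. a r k = 0}"
  have "(\<exists>C. finite C \<and> laurent_span C = V) \<and> laurent_dim V \<le> card ({u..<u + int r} \<union> ?Z)"
  proof (rule laurent.dim_le_of_separating[where \<phi> = "\<lambda>k f. f k"])
    fix f assume "f \<in> V" and z: "\<forall>k\<in>{u..<u + int r} \<union> ?Z. f k = 0"
    then have f: "recurrence a r k f = 0" for k by (simp add: V_def)
    have R: "f n = 0" if "u \<le> n" for n
      by (rule recurrence_extend_right[of u a r]) (use f z that in auto)
    have "f n = 0" if "n < u + int r" for n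
      by (rule recurrence_extend_left[of u a r]) (use f outside R that in auto)
    moreover have "u \<le> n \<or> n < u + int r" for n by linarith
    ultimately show "f = 0" using R by fastforce
  qed (use Zr sV in \<open>auto simp: laurent_scale_def\<close>)
  moreover have "card ({u..<u + int r} \<union> ?Z) \<le> r + card {k. a r k = 0}"
    using card_Un_le[of "{u..<u + int r}" ?Z] card_image_le[OF Zr, of "\<lambda>k. k + int r"] by simp
  ultimately show "laurent_dim V \<le> r + card {k. a r k = 0}" by simp

  \<comment> \<open>\<open>?U\<close> drops the \<open>v - u\<close> equations of the window. It
    contains \<open>v - u + r\<close> independent sequences \<open>e j\<close>, and restoring these
    equations loses at most \<open>v - u\<close> dimensions.\<close>
  let ?U = "{f. \<forall>k\<in>{..<u} \<union> {v..}. recurrence a r k f = 0}"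
  have "\<exists>f. (\<forall>n. u \<le> n \<and> n < v + int r \<longrightarrow> f n = (if j = n then 1 else 0))
    \<and> (\<forall>k. k < u \<or> v \<le> k \<longrightarrow> recurrence a r k f = 0)" for j
    by (rule recurrence_solution_exists) (use outside \<open>u \<le> v\<close> in auto)
  then obtain e where e: "\<And>j n. u \<le> n \<Longrightarrow> n < v + int r \<Longrightarrow> e j n = (if j = n then 1 else 0)"
      "\<And>j k. k < u \<or> v \<le> k \<Longrightarrow> recurrence a r k (e j) = 0"
    by metis
  let ?I = "{u..<v + int r}"
  have ind: "laurent.independent (e ` ?I)" "card (e ` ?I) = card ?I"
    by (rule independent_of_dual; simp add: e)+
  have "card (e ` ?I) \<le> laurent_dim V + card {u..<v}"
  proof (rule laurent.card_le_dim_plus_codim)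
    have "k \<in> {..<u} \<union> {v..} \<or> k \<in> {u..<v}" for k by auto
    then show "V = {f \<in> ?U. \<forall>k\<in>{u..<v}. recurrence a r k f = 0}"
      unfolding V_def by blast
    show "e ` ?I \<subseteq> ?U" using e(2) by auto
    show "\<exists>B. finite B \<and> laurent_span B = V" using fd by (simp add: laurent_finite_dim_def)
  qed (simp_all add: ind recurrence_add recurrence_scale subspace_recurrence)
  then show "r \<le> laurent_dim V" using \<open>u \<le> v\<close> by (simp add: ind(2))
qed

subsection \<open>Normal forms in the $q$-Heisenberg algebra\<close>

lemma sum_laurent_apply: "(\<Sum>i\<in>A. F i) n = (\<Sum>i\<in>A. F i n)" for F :: "'k \<Rightarrow> 'a::field laurent"
  by (induction A rule: infinite_finite_induct) auto

lemma sum_op_apply: "(\<Sum>i\<in>A. F i) f = (\<Sum>i\<in>A. F i f)" for F :: "'k \<Rightarrow> 'a::field laurent_op"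
  by (induction A rule: infinite_finite_induct) auto

lemma q_int_0 [simp]: "q_int q 0 = 0"
  by (simp add: q_int_def)

text \<open>This addition formula is behind the injectivity of \<open>q_int\<close>, the commutation
  of D_q with powers of M, and the polynomial form of \<open>q_falling\<close>.\<close>

lemma q_int_add:
  assumes "q \<noteq> 0"
  shows "q_int q (m + n) = q powi n * q_int q m + q_int q n"
proof (cases "q = 1")
  case False
  then show ?thesis using assms
    by (simp add: q_int_def power_int_add divide_simps) (simp add: algebra_simps)
qed (simp add: q_int_def)

lemma inj_q_int:
  assumes "q \<noteq> 0" and nz: "\<And>n::int. n \<noteq> 0 \<Longrightarrow> q_int q n \<noteq> 0"
  shows "inj (q_int q)"
proof (rule injI)
  fix m n assume "q_int q m = q_int q n"
  then have "q powi n * q_int q (m - n) = 0"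
    using q_int_add[OF assms(1), of "m - n" n] by simp
  then show "m = n" using nz[of "m - n"] assms(1) by auto
qed

lemma q_falling_0 [simp]: "q_falling q k 0 = 1"
  by (simp add: q_falling_def)

lemma q_falling_Suc: "q_falling q k (Suc j) = q_falling q k j * q_int q (k - int j)"
  by (simp add: q_falling_def)

lemma q_falling_eq_0: "i < j \<Longrightarrow> q_falling q (int i) j = 0"
  by (auto simp: q_falling_def intro!: prod_zero bexI[of _ i])

section \<open>Coefficients of an operator in normal form\<close>

lemma shift_op_power: "(shift_op ^^ i) f n = f (n - int i)"
  by (induction i arbitrary: n) (simp_all add: shift_op_def algebra_simps)

lemma q_deriv_power: "(q_deriv q ^^ j) f n = q_falling q (n + int j) j * f (n + int j)"
  by (induction j arbitrary: n) (simp_all add: q_deriv_def q_falling_Suc algebra_simps)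

lemma op_of_poly_apply:
  "op_of_poly q p f n = (\<Sum>j\<le>degree p. \<Sum>i\<le>degree (coeff p j).
     coeff (coeff p j) i * (q_falling q (n - int i + int j) j * f (n - int i + int j)))"
  by (simp add: op_of_poly_def poly_shift_def sum_op_apply sum_laurent_apply op_scale_def
      laurent_scale_def shift_op_power q_deriv_power)

text \<open>The additional coefficients are zero. Common bounds allow operators of different degrees
  to be compared termwise.\<close>

lemma op_of_poly_apply_bound:
  assumes J: "degree p \<le> J" and I: "\<And>j. degree (coeff p j) \<le> I"
  shows "op_of_poly q p f n = (\<Sum>j\<le>J. \<Sum>i\<le>I.
     coeff (coeff p j) i * (q_falling q (n - int i + int j) j * f (n - int i + int j)))"
proof -
  define g where "g j i = q_falling q (n - int i + int j) j * f (n - int i + int j)" for i j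
  have "(\<Sum>i\<le>degree (coeff p j). coeff (coeff p j) i * g j i) = (\<Sum>i\<le>I. coeff (coeff p j) i * g j i)" for j
    using I by (intro sum.mono_neutral_left) (auto simp: coeff_eq_0)
  moreover have "(\<Sum>j\<le>degree p. \<Sum>i\<le>I. coeff (coeff p j) i * g j i)
      = (\<Sum>j\<le>J. \<Sum>i\<le>I. coeff (coeff p j) i * g j i)"
    using J by (intro sum.mono_neutral_left) (auto simp: coeff_eq_0)
  ultimately show ?thesis by (simp add: op_of_poly_apply g_def)
qed

lemma degree_coeff_bound:
  fixes p :: "'a::field poly poly"
  shows "\<exists>I. \<forall>j. degree (coeff p j) \<le> I"
proof -
  have "degree (coeff p j) \<le> (\<Sum>j\<le>degree p. degree (coeff p j))" for j
    by (cases "j \<le> degree p") (auto intro!: member_le_sum simp: coeff_eq_0)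
  then show ?thesis by blast
qed

lemma op_of_poly_add: "op_of_poly q (p + p') = op_of_poly q p + op_of_poly q p'"
proof (intro ext)
  fix f n
  obtain I I' where I: "\<And>j. degree (coeff p j) \<le> I" "\<And>j. degree (coeff p' j) \<le> I'"
    using degree_coeff_bound by metis
  let ?J = "max (degree p) (degree p')" and ?I = "max I I'"
  have le: "degree (coeff p j) \<le> ?I" "degree (coeff p' j) \<le> ?I" for j
    using I[of j] by auto
  then have le': "degree (coeff (p + p') j) \<le> ?I" for j
    unfolding coeff_add by (intro degree_add_le)
  note b = op_of_poly_apply_bound[of _ ?J ?I]
  have "op_of_poly q (p + p') f n = op_of_poly q p f n + op_of_poly q p' f n"
    unfolding b[of "p + p'", OF degree_add_le_max le'] b[of p, OF max.cobounded1 le(1)]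
      b[of p', OF max.cobounded2 le(2)]
    by (simp add: sum.distrib ring_distribs)
  then show "op_of_poly q (p + p') f n = (op_of_poly q p + op_of_poly q p') f n" by simp
qed

lemma op_of_poly_monom:
  "op_of_poly q (monom (monom c i) j) f n = c * (q_falling q (n - int i + int j) j * f (n - int i + int j))"
proof -
  let ?p = "monom (monom c i) j"
  have "op_of_poly q ?p f n = (\<Sum>j'\<le>j. \<Sum>i'\<le>i. coeff (coeff ?p j') i' *
      (q_falling q (n - int i' + int j') j' * f (n - int i' + int j')))"
    by (rule op_of_poly_apply_bound) (simp_all add: degree_monom_le)
  also have "\<dots> = (\<Sum>j'\<le>j. if j = j' then
      c * (q_falling q (n - int i + int j) j * f (n - int i + int j)) else 0)"
    by (intro sum.cong refl) (simp add: if_distrib[of "\<lambda>x. x * _"] cong: if_cong)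
  finally show ?thesis by simp
qed

lemma op_of_poly_0: "op_of_poly q 0 = 0"
  by (intro ext) (simp add: op_of_poly_apply)

lemma op_of_poly_scale: "op_scale c (op_of_poly q p) = op_of_poly q (smult [:c:] p)"
proof (intro ext)
  fix f n
  obtain I where I: "\<And>j. degree (coeff p j) \<le> I" using degree_coeff_bound by metis
  have I': "degree (coeff (smult [:c:] p) j) \<le> I" for j
    using I[of j] degree_smult_le[of c "coeff p j"] by simp
  show "op_scale c (op_of_poly q p) f n = op_of_poly q (smult [:c:] p) f n"
    by (simp add: op_of_poly_apply_bound[OF order_refl I]
        op_of_poly_apply_bound[OF degree_smult_le I'] op_scale_def laurent_scale_def
        sum_distrib_left mult.assoc)
qed

lemma op_of_poly_sum: "(\<Sum>x\<in>A. op_of_poly q (g x)) = op_of_poly q (\<Sum>x\<in>A. g x)"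
  by (induction A rule: infinite_finite_induct) (auto simp: op_of_poly_0 op_of_poly_add)

lemma op_of_poly_sum_monom:
  "op_of_poly q p = (\<Sum>j\<le>degree p. \<Sum>i\<le>degree (coeff p j).
     op_of_poly q (monom (monom (coeff (coeff p j) i) i) j))"
  by (intro ext, simp only: sum_op_apply sum_laurent_apply op_of_poly_monom, rule op_of_poly_apply)

text \<open>By additivity it suffices to rewrite \<open>X\<close> composed with each monomial c M^i
  D_q^j. The normal forms chosen for these are then added up.\<close>

lemma comp_op_of_poly:
  assumes add: "\<And>f g. X (f + g) = X f + X g"
    and monom: "\<And>c i j. X \<circ> op_of_poly q (monom (monom c i) j) \<in> range (op_of_poly q)"
  shows "X \<circ> op_of_poly q p \<in> range (op_of_poly q)"
proof -
  have X0: "X 0 = 0" using add[of 0 0] by simp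
  have sum: "X \<circ> (\<Sum>i\<in>A. F i) = (\<Sum>i\<in>A. X \<circ> F i)" for A :: "nat set" and F
    by (rule ext, induction A rule: infinite_finite_induct) (auto simp: X0 add)
  obtain g where g: "\<And>c i j. X \<circ> op_of_poly q (monom (monom c i) j) = op_of_poly q (g c i j)"
    using monom unfolding image_iff by metis
  have "X \<circ> op_of_poly q p = (\<Sum>j\<le>degree p. \<Sum>i\<le>degree (coeff p j). op_of_poly q (g (coeff (coeff p j) i) i j))"
    by (subst op_of_poly_sum_monom) (simp only: sum g)
  then show ?thesis by (simp add: op_of_poly_sum)
qed

text \<open>The q-Leibniz rule: D_q M^i equals q^i M^i D_q plus \<open>q_int q i\<close> times
  M^(i-1).\<close>

lemma q_deriv_comp_monom:
  assumes "q \<noteq> 0"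
  shows "q_deriv q \<circ> op_of_poly q (monom (monom c i) j)
    = op_of_poly q (monom (monom (c * q ^ i) i) (Suc j) + monom (monom (c * q_int q (int i)) (i - 1)) j)"
proof (intro ext)
  fix f n
  have D: "q_int q (n + 1) = q ^ i * q_int q (n + 1 - int i) + q_int q (int i)"
    using q_int_add[OF assms, of "n + 1 - int i" "int i"] by simp
  have S: "n - int i + int (Suc j) = n + 1 - int i + int j" by simp
  have F: "q_falling q (n + 1 - int i + int j) (Suc j)
      = q_falling q (n + 1 - int i + int j) j * q_int q (n + 1 - int i)"
    by (simp add: q_falling_Suc)
  \<comment> \<open>For \<open>i = 0\<close> the truncated \<open>i - 1\<close> is harmless, since
    the factor \<open>q_int q 0\<close> vanishes.\<close>
  have I: "q_int q (int i) * h (n - int (i - 1) + int j) = q_int q (int i) * h (n + 1 - int i + int j)"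
    for h :: "int \<Rightarrow> 'a"
    by (cases i) simp_all
  show "(q_deriv q \<circ> op_of_poly q (monom (monom c i) j)) f n = op_of_poly q (monom (monom (c * q ^ i) i)
      (Suc j) + monom (monom (c * q_int q (int i)) (i - 1)) j) f n"
    using I[of "\<lambda>k. q_falling q k j * f k"]
    by (simp only: comp_apply q_deriv_def op_of_poly_add plus_fun_apply op_of_poly_monom S F D)
      (simp only: ring_distribs mult_ac)
qed

lemma shift_op_comp_monom:
  "shift_op \<circ> op_of_poly q (monom (monom c i) j) = op_of_poly q (monom (monom c (Suc i)) j)"
  by (intro ext) (simp add: shift_op_def op_of_poly_monom algebra_simps)

text \<open>The operators in normal form are closed under left multiplication by the generators.
  With \<open>p\<close> arbitrary in the induction, a product \<open>P \<circ> Q\<close> is treated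
  by applying first \<open>Q\<close>, then \<open>P\<close>.\<close>

lemma q_heisenberg_comp_op_of_poly:
  assumes "q \<noteq> 0" "P \<in> q_heisenberg q"
  shows "P \<circ> op_of_poly q p \<in> range (op_of_poly q)"
  using assms(2)
proof (induction arbitrary: p)
  case deriv
  show ?case
    by (rule comp_op_of_poly) (auto simp: q_deriv_comp_monom[OF assms(1)], simp add: q_deriv_def fun_eq_iff algebra_simps)
next
  case shift
  show ?case
    by (rule comp_op_of_poly) (auto simp: shift_op_comp_monom, simp add: shift_op_def fun_eq_iff)
next
  case (scale P c)
  obtain p' where "P \<circ> op_of_poly q p = op_of_poly q p'" using scale.IH by (metis imageE)
  moreover have "op_scale c P \<circ> op_of_poly q p = op_scale c (P \<circ> op_of_poly q p)"
    by (simp add: op_scale_def fun_eq_iff)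
  ultimately show ?case by (auto simp: op_of_poly_scale)
next
  case (add P Q)
  obtain p1 p2 where "P \<circ> op_of_poly q p = op_of_poly q p1" "Q \<circ> op_of_poly q p = op_of_poly q p2"
    using add.IH by (metis imageE)
  moreover have "(P + Q) \<circ> op_of_poly q p = (P \<circ> op_of_poly q p) + (Q \<circ> op_of_poly q p)"
    by (simp add: fun_eq_iff)
  ultimately have "(P + Q) \<circ> op_of_poly q p = op_of_poly q (p1 + p2)"
    by (simp add: op_of_poly_add)
  then show ?case by blast
next
  case (comp P Q)
  obtain p' where "Q \<circ> op_of_poly q p = op_of_poly q p'" using comp.IH(2) by (metis imageE)
  then show ?case using comp.IH(1)[of p'] by (simp only: comp_assoc)
qed simp

lemma q_heisenberg_normal_form_exists:
  assumes "q \<noteq> 0" "P \<in> q_heisenberg q"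
  shows "\<exists>p. P = op_of_poly q p"
proof -
  \<comment> \<open>The identity is itself in normal form, so composing \<open>P\<close> with it
    gives a normal form of \<open>P\<close>.\<close>
  have "op_of_poly q (monom (monom 1 0) 0) = id"
    by (intro ext) (simp only: op_of_poly_monom, simp)
  then show ?thesis using q_heisenberg_comp_op_of_poly[OF assms, of "monom (monom 1 0) 0"] by auto
qed

subsection \<open>The functions \<open>\<beta>\<^sub>d\<close>\<close>

text \<open>The coefficient of M^(j+d) D_q^j, extended by zero so that the range of \<open>j\<close>
  does not depend on \<open>d\<close>.\<close>

definition diag_coeff :: "'a::field poly poly \<Rightarrow> int \<Rightarrow> nat \<Rightarrow> 'a" where
  "diag_coeff p d j = (if 0 \<le> int j + d then coeff (coeff p j) (nat (int j + d)) else 0)"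

lemma beta_poly_diag_coeff:
  assumes "degree p \<le> J"
  shows "beta_poly q p d k = (\<Sum>j\<le>J. diag_coeff p d j * q_falling q k j)"
  unfolding beta_poly_def diag_coeff_def
  using assms by (intro sum.mono_neutral_cong_left) (auto intro!: le_degree)

lemma beta_poly_support:
  assumes I: "\<And>j. degree (coeff p j) \<le> I"
  shows "{d. beta_poly q p d \<noteq> 0} \<subseteq> {- int (degree p)..int I}"
proof
  fix d assume "d \<in> {d. beta_poly q p d \<noteq> 0}"
  then obtain k where "beta_poly q p d k \<noteq> 0" by (auto simp: fun_eq_iff)
  then obtain j where j: "j \<le> degree p" "diag_coeff p d j \<noteq> 0"
    unfolding beta_poly_diag_coeff[OF order_refl] by (auto elim: sum.not_neutral_contains_not_neutral)
  then have "nat (int j + d) \<le> degree (coeff p j)" "0 \<le> int j + d"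
    by (auto simp: diag_coeff_def intro!: le_degree split: if_splits)
  then show "d \<in> {- int (degree p)..int I}" using I[of j] j(1) by auto
qed

lemma finite_beta_poly: "finite {d. beta_poly q p d \<noteq> 0}"
proof -
  obtain I where I: "\<And>j. degree (coeff p j) \<le> I" using degree_coeff_bound by metis
  show ?thesis by (rule finite_subset[OF beta_poly_support[OF I]]) simp
qed

text \<open>The terms M^i D_q^j are grouped by \<open>d = i - j\<close>, since each maps t^(n-d) to
  a multiple of t^n. The set \<open>T\<close> is left free so that an empty set, an interval or an
  enlarged support can be inserted.\<close>

lemma op_of_poly_beta:
  assumes T: "finite T" "{d. beta_poly q p d \<noteq> 0} \<subseteq> T"
  shows "op_of_poly q p f n = (\<Sum>d\<in>T. beta_poly q p d (n - d) * f (n - d))"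
proof -
  obtain I where I: "\<And>j. degree (coeff p j) \<le> I" using degree_coeff_bound by metis
  define J where "J = degree p"
  let ?D = "{- int J..int I}"
  \<comment> \<open>Substitute \<open>d = i - j\<close>, then enlarge the range to one common to all
    \<open>j\<close>; \<open>diag_coeff\<close> is zero on the rest.\<close>
  have reindex: "(\<Sum>i\<le>I. coeff (coeff p j) i * g (int i - int j))
      = (\<Sum>d\<in>?D. diag_coeff p d j * g d)" if "j \<le> J" for j and g :: "int \<Rightarrow> 'a"
  proof -
    have "(\<Sum>i\<le>I. coeff (coeff p j) i * g (int i - int j))
        = (\<Sum>d\<in>{- int j..int I - int j}. diag_coeff p d j * g d)"
      by (rule sum.reindex_bij_witness[where i = "\<lambda>d. nat (d + int j)" and j = "\<lambda>i. int i - int j"])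
        (auto simp: diag_coeff_def)
    also have "\<dots> = (\<Sum>d\<in>?D. diag_coeff p d j * g d)"
      using that le_less_trans[OF I]
      by (intro sum.mono_neutral_left) (auto simp: diag_coeff_def coeff_eq_0)
    finally show ?thesis .
  qed
  have "op_of_poly q p f n = (\<Sum>j\<le>J. \<Sum>i\<le>I. coeff (coeff p j) i *
      (q_falling q (n - (int i - int j)) j * f (n - (int i - int j))))"
    unfolding J_def by (subst op_of_poly_apply_bound[OF order_refl I]) (simp add: algebra_simps)
  also have "\<dots> = (\<Sum>j\<le>J. \<Sum>d\<in>?D. diag_coeff p d j * (q_falling q (n - d) j * f (n - d)))"
    by (intro sum.cong refl reindex[where g = "\<lambda>d. q_falling q (n - d) _ * f (n - d)"]) simp
  also have "\<dots> = (\<Sum>d\<in>?D. beta_poly q p d (n - d) * f (n - d))"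
    by (subst sum.swap) (simp add: beta_poly_diag_coeff[OF order_refl] J_def sum_distrib_right mult.assoc)
  also have "\<dots> = (\<Sum>d\<in>{d. beta_poly q p d \<noteq> 0}. beta_poly q p d (n - d) * f (n - d))"
    by (rule sum.mono_neutral_right) (use beta_poly_support[OF I, of q] in \<open>auto simp: J_def\<close>)
  also have "\<dots> = (\<Sum>d\<in>T. beta_poly q p d (n - d) * f (n - d))"
    by (rule sum.mono_neutral_left) (use T in auto)
  finally show ?thesis .
qed

text \<open>Applying the operator to t^k and reading off the coefficient of t^(d+k) shows that
  \<beta> depends on the operator alone.\<close>

lemma beta_poly_eq_op_of_poly:
  "beta_poly q p d k = op_of_poly q p (\<lambda>n. if n = k then 1 else 0) (d + k)"
proof -
  let ?T = "insert d {d. beta_poly q p d \<noteq> 0}"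
  have "op_of_poly q p (\<lambda>n. if n = k then 1 else 0) (d + k)
      = (\<Sum>d'\<in>?T. beta_poly q p d' (d + k - d') * (if d + k - d' = k then 1 else 0))"
    by (rule op_of_poly_beta) (use finite_beta_poly in auto)
  also have "\<dots> = (\<Sum>d'\<in>?T. if d' = d then beta_poly q p d k else 0)"
    by (intro sum.cong) auto
  also have "\<dots> = beta_poly q p d k"
    using finite_beta_poly by (subst sum.delta) auto
  finally show ?thesis by simp
qed

text \<open>The system at \<open>k = 0, 1, ..., J\<close> is triangular: at \<open>k = j\<close> the
  terms beyond \<open>j\<close> contain the factor \<open>q_int q 0\<close>, and the diagonal entry
  is a product of non-zero q-integers.\<close>

lemma q_falling_independent:
  assumes nz: "\<And>n::int. n \<noteq> 0 \<Longrightarrow> q_int q n \<noteq> 0"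
    and 0: "\<And>k. (\<Sum>j\<le>J. c j * q_falling q k j) = 0" and "j \<le> J"
  shows "c j = 0"
  using \<open>j \<le> J\<close>
proof (induction j rule: less_induct)
  case (less j)
  have "0 = (\<Sum>i\<le>J. c i * q_falling q (int j) i)" using 0 by simp
  also have "\<dots> = (\<Sum>i\<le>J. if i = j then c j * q_falling q (int j) j else 0)"
  proof (rule sum.cong)
    fix i assume "i \<in> {..J}"
    then show "c i * q_falling q (int j) i = (if i = j then c j * q_falling q (int j) j else 0)"
      using less.IH[of i] q_falling_eq_0[of j i q] by (cases i j rule: linorder_cases) auto
  qed simp
  also have "\<dots> = c j * q_falling q (int j) j" using less.prems by simp
  finally show ?case using nz by (auto simp: q_falling_def)
qed

text \<open>Equal operators have equal \<beta>, and independence of the falling products recovers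
  every coefficient, that of M^i D_q^j from \<open>d = i - j\<close>.\<close>

lemma op_of_poly_inj:
  assumes nz: "\<And>n::int. n \<noteq> 0 \<Longrightarrow> q_int q n \<noteq> 0"
    and eq: "op_of_poly q p = op_of_poly q p'"
  shows "p = p'"
proof (intro poly_eqI)
  fix j i
  let ?J = "max (max (degree p) (degree p')) j"
  let ?d = "int i - int j"
  have "diag_coeff p ?d j - diag_coeff p' ?d j = 0"
  proof (rule q_falling_independent[where J = ?J and c = "\<lambda>l. diag_coeff p ?d l - diag_coeff p' ?d l", OF nz])
    fix k
    have "(\<Sum>l\<le>?J. diag_coeff p ?d l * q_falling q k l) = (\<Sum>l\<le>?J. diag_coeff p' ?d l * q_falling q k l)"
      using beta_poly_eq_op_of_poly[of q p ?d k] beta_poly_eq_op_of_poly[of q p' ?d k] eq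
      by (simp add: beta_poly_diag_coeff[of _ ?J])
    then show "(\<Sum>l\<le>?J. (diag_coeff p ?d l - diag_coeff p' ?d l) * q_falling q k l) = 0"
      by (simp add: left_diff_distrib sum_subtractf)
  qed simp_all
  then show "coeff (coeff p j) i = coeff (coeff p' j) i" by (simp add: diag_coeff_def)
qed

lemma normal_form_op_of_poly:
  assumes "\<And>n::int. n \<noteq> 0 \<Longrightarrow> q_int q n \<noteq> 0"
  shows "normal_form q (op_of_poly q p) = p"
  unfolding normal_form_def by (rule the_equality) (use op_of_poly_inj[OF assms] in auto)

section \<open>Zeros of the functions \<beta>\<close>

lemma q_falling_poly:
  assumes "q \<noteq> 0"
  shows "\<exists>Q. degree Q \<le> j \<and> (\<forall>k. poly Q (q_int q k) = q_falling q k j)"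
proof (induction j)
  case 0
  show ?case by (rule exI[of _ 1]) simp
next
  case (Suc j)
  then obtain Q where Q: "degree Q \<le> j" "\<And>k. poly Q (q_int q k) = q_falling q k j" by auto
  \<comment> \<open>By \<open>q_int_add\<close>, the value of this linear polynomial at
    \<open>q_int q k\<close> is the next factor \<open>q_int q (k - j)\<close>.\<close>
  let ?L = "[:q_int q (- int j), q powi (- int j):]"
  have "poly (Q * ?L) (q_int q k) = q_falling q k (Suc j)" for k
    using q_int_add[OF assms, of k "- int j"] by (simp add: Q q_falling_Suc algebra_simps)
  moreover have "degree (Q * ?L) \<le> Suc j"
    using degree_mult_le[of Q ?L] degree_pCons_le[of "q_int q (- int j)" "[:q powi (- int j):]"] Q(1)
    by simp
  ultimately show ?case by blast
qed

text \<open>\<open>beta_poly q p d k\<close> is a polynomial of degree at most \<open>degree p\<close> in \<open>q_int q k\<close>.\<close>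

lemma beta_poly_zeros:
  assumes q: "q \<noteq> 0" and nz: "\<And>n::int. n \<noteq> 0 \<Longrightarrow> q_int q n \<noteq> 0"
    and "beta_poly q p d \<noteq> 0"
  shows "finite {k. beta_poly q p d k = 0}" "card {k. beta_poly q p d k = 0} \<le> degree p"
proof -
  obtain Q where Q: "\<And>j. degree (Q j) \<le> j" "\<And>j k. poly (Q j) (q_int q k) = q_falling q k j"
    using q_falling_poly[OF q] by metis
  define G where "G = (\<Sum>j\<le>degree p. smult (diag_coeff p d j) (Q j))"
  have G: "poly G (q_int q k) = beta_poly q p d k" for k
    by (simp add: G_def poly_sum Q beta_poly_diag_coeff[OF order_refl])
  have "degree G \<le> degree p" unfolding G_def
    by (rule degree_sum_le) (auto intro: order_trans[OF degree_smult_le] order_trans[OF Q(1)])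
  moreover have "G \<noteq> 0" using assms(3) G by (auto simp: fun_eq_iff)
  ultimately have roots: "finite {x. poly G x = 0}" "card {x. poly G x = 0} \<le> degree p"
    using poly_roots_finite[of G] card_poly_roots_bound[of G] by auto
  \<comment> \<open>Since \<open>q_int q\<close> is injective, distinct zeros \<open>k\<close> give
    distinct roots of the non-zero polynomial \<open>G\<close>.\<close>
  have sub: "q_int q ` {k. beta_poly q p d k = 0} \<subseteq> {x. poly G x = 0}" using G by auto
  have inj: "inj_on (q_int q) {k. beta_poly q p d k = 0}"
    using inj_q_int[OF q nz] by (rule inj_on_subset) auto
  show "finite {k. beta_poly q p d k = 0}"
    using inj_on_finite[OF inj sub roots(1)] .
  show "card {k. beta_poly q p d k = 0} \<le> degree p"
    using card_inj_on_le[OF inj sub roots(1)] roots(2) by linarith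
qed

section \<open>The kernel of P as the solution space of a recurrence\<close>

theorem proposition3p3:
  fixes q :: "'a::field" and P :: "'a laurent_op"
  assumes "q \<noteq> 0"
    and "\<And>n::int. n \<noteq> 0 \<Longrightarrow> q_int q n \<noteq> 0"
    and "P \<in> q_heisenberg q"
    and "P \<noteq> 0"
  shows "laurent_finite_dim (op_kernel P)
    \<and> d_max q P - d_min q P \<le> int (laurent_dim (op_kernel P))
    \<and> int (laurent_dim (op_kernel P))
        \<le> d_max q P - d_min q P + int (min (N_max q P) (N_min q P))
    \<and> d_max q P - d_min q P + int (min (N_max q P) (N_min q P))
        \<le> d_max q P - d_min q P + int (op_order q P)"
proof -
  obtain p where P: "P = op_of_poly q p"
    using q_heisenberg_normal_form_exists assms(1,3) by blast
  have nf: "normal_form q P = p" using normal_form_op_of_poly[OF assms(2)] P by simp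
  define b where "b = beta_poly q p"
  have b: "beta q P = b" by (simp add: beta_def nf b_def)
  have fin: "finite {d. b d \<noteq> 0}" unfolding b_def by (rule finite_beta_poly)
  have ne: "{d. b d \<noteq> 0} \<noteq> {}"
  proof
    assume "{d. b d \<noteq> 0} = {}"
    then have "P f n = 0" for f n
      using op_of_poly_beta[of "{}" q p f n] by (simp add: P b_def)
    then show False using \<open>P \<noteq> 0\<close> by (auto simp: fun_eq_iff)
  qed
  define d1 where "d1 = d_max q P"
  define d0 where "d0 = d_min q P"
  have d1: "b d1 \<noteq> 0" and d0: "b d0 \<noteq> 0"
    using Max_in[OF fin ne] Min_in[OF fin ne] by (auto simp: d1_def d0_def d_max_def d_min_def b)
  have sub: "{d. b d \<noteq> 0} \<subseteq> {d0..d1}"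
    using fin by (auto simp: d1_def d0_def d_max_def d_min_def b)
  define r where "r = nat (d1 - d0)"
  have r: "int r = d1 - d0" using sub d1 by (auto simp: r_def)
  \<comment> \<open>The index \<open>i\<close> counts down from d_max, so that \<open>i = 0\<close>
    belongs to d_max and \<open>i = r\<close> to d_min. The argument \<open>k + i\<close> is
    \<open>n - d\<close> for \<open>n = k + d1\<close> and \<open>d = d1 - i\<close>.\<close>
  define a where "a i k = b (d1 - int i) (k + int i)" for i k
  have rec: "recurrence a r k f = P f (k + d1)" for k f
  proof -
    have "P f (k + d1) = (\<Sum>d\<in>{d0..d1}. b d (k + d1 - d) * f (k + d1 - d))"
      unfolding P b_def by (rule op_of_poly_beta) (use sub in \<open>auto simp: b_def\<close>)
    also have "\<dots> = (\<Sum>i\<le>r. b (d1 - int i) (k + int i) * f (k + int i))"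
      by (rule sum.reindex_bij_witness[where i = "\<lambda>i. d1 - int i" and j = "\<lambda>d. nat (d1 - d)"])
        (use r in \<open>auto simp: algebra_simps\<close>)
    finally show ?thesis by (simp add: recurrence_def a_def)
  qed
  have ker: "op_kernel P = {f. \<forall>k. recurrence a r k f = 0}"
  proof -
    have "P f = 0 \<longleftrightarrow> (\<forall>k. P f (k + d1) = 0)" for f
      by (auto simp: fun_eq_iff) (metis diff_add_cancel)
    then show ?thesis by (simp add: op_kernel_def rec)
  qed
  have Z0: "{k. a 0 k = 0} = {k. b d1 k = 0}" by (simp add: a_def)
  \<comment> \<open>\<open>a r k\<close> is \<open>b d0 (k + r)\<close>, so its zeros are those of
    \<open>b d0\<close> translated by \<open>r\<close>, equal in number.\<close>
  have "bij_betw (\<lambda>k. k + int r) {k. a r k = 0} {k. b d0 k = 0}"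
    by (rule bij_betw_byWitness[where f' = "\<lambda>k. k - int r"]) (auto simp: a_def r)
  then have Zr: "card {k. a r k = 0} = card {k. b d0 k = 0}"
    "finite {k. a r k = 0} \<longleftrightarrow> finite {k. b d0 k = 0}"
    by (auto dest: bij_betw_same_card bij_betw_finite)
  note zeros = beta_poly_zeros[OF assms(1,2), of p, folded b_def]
  note dim = recurrence_kernel_dim[of a r, folded ker]
  have "finite {k. a 0 k = 0}" "finite {k. a r k = 0}"
    using zeros(1)[OF _ d1] zeros(1)[OF _ d0] by (auto simp: Z0 Zr)
  note dim = dim[OF this]
  have N: "N_max q P = card {k. a 0 k = 0}" "N_min q P = card {k. a r k = 0}"
    by (simp_all add: N_max_def N_min_def b Z0 Zr d1_def d0_def)
  \<comment> \<open>Bounding one of the two numbers by the order bounds their minimum.\<close>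
  have "N_max q P \<le> op_order q P"
    using zeros(2)[OF _ d1] by (simp add: N Z0 op_order_def nf)
  then show ?thesis
    using dim r by (simp add: N min_def flip: d1_def d0_def)
qed

end
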